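(* Let $G$ be a finite, simple, undirected, connected graph. If $G$ has the partially augmented consecutive ones property ( *-C1P), then $G$ has no $2$-asteroidal triple.
   Context: A $0/1$ matrix has the consecutive ones property (C1P, for columns) if there is a permutation of its rows that places the 1s consecutively in every column. An $n$-vertex graph $G$ has the partially augmented consecutive ones property ( *-C1P) if there is an adjacency matrix $(A_{i,j})_{(i,j)\in[n]^2}$ of $G$ and a matrix $(A^*_{i,j})_{(i,j)\in[n]^2}$ with $A^*_{i,j}=A_{i,j}$ for all $i\neq j$ and $A^*_{i,i}\in\{0,1\}$ for all $i$, such that $A^*$ has the C1P. Equivalently, there is a total ordering of $V(G)$ such that for every vertex $v$, either the open neighborhood $N(v)$ or the closed neighborhood $N[v]=N(v)\cup\{v\}$ is a set of consecutive vertices in the ordering. For a vertex $v$, $N^2[v]$ denotes the set of all vertices of $G$ at distance at most $2$ from $v$. A $2$-asteroidal triple ($2$-AT) of $G$ is a set of three vertices such that each pair of them is joined by a path of $G$ containing no vertex of $N^2[w]$, where $w$ is the third vertex of the set. *)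

theory Defs
  imports
    "Graph_Theory.Graph_Theory"
    "Jordan_Normal_Form.Matrix"
begin

text \<open>Only the rows are permuted: \<open>\<pi>\<close> lists the row indices in their new order.\<close>

definition C1P :: "nat mat \<Rightarrow> bool" where
  "C1P M \<longleftrightarrow> elements_mat M \<subseteq> {0, 1} \<and>
    (\<exists>\<pi>. \<pi> permutes {..<dim_row M} \<and>
      (\<forall>j < dim_col M. \<forall>i k l. i \<le> k \<and> k \<le> l \<and> l < dim_row M \<and>
        M $$ (\<pi> i, j) = 1 \<and> M $$ (\<pi> l, j) = 1 \<longrightarrow> M $$ (\<pi> k, j) = 1))"

text \<open>Rows and columns are indexed by one and the same enumeration \<open>f\<close> of the vertices.\<close>

definition is_adjacency_mat :: "('a, 'b) pre_digraph \<Rightarrow> nat mat \<Rightarrow> bool" where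
  "is_adjacency_mat G A \<longleftrightarrow>
    (\<exists>f. bij_betw f {..<card (verts G)} (verts G) \<and>
      A = mat (card (verts G)) (card (verts G)) (\<lambda>(i, j). if f i \<rightarrow>\<^bsub>G\<^esub> f j then 1 else 0))"

definition star_C1P :: "('a, 'b) pre_digraph \<Rightarrow> bool" where
  "star_C1P G \<longleftrightarrow>
    (\<exists>A A'. is_adjacency_mat G A \<and>
      A' \<in> carrier_mat (card (verts G)) (card (verts G)) \<and>
      (\<forall>i < card (verts G). \<forall>j < card (verts G). i \<noteq> j \<longrightarrow> A' $$ (i, j) = A $$ (i, j)) \<and>
      (\<forall>i < card (verts G). A' $$ (i, i) \<in> {0, 1}) \<and>
      C1P A')"

text \<open>Graph distance is the cost of a cheapest walk when every arc costs \<open>1\<close>.\<close>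

definition graph_dist :: "('a, 'b) pre_digraph \<Rightarrow> 'a \<Rightarrow> 'a \<Rightarrow> ereal" where
  "graph_dist G u v = wf_digraph.\<mu> G (\<lambda>_. 1) u v"

definition nbhd2 :: "('a, 'b) pre_digraph \<Rightarrow> 'a \<Rightarrow> 'a set" where
  "nbhd2 G v = {u \<in> verts G. graph_dist G v u \<le> 2}"

definition two_asteroidal_triple :: "('a, 'b) pre_digraph \<Rightarrow> 'a set \<Rightarrow> bool" where
  "two_asteroidal_triple G T \<longleftrightarrow> T \<subseteq> verts G \<and> card T = 3 \<and>
    (\<forall>u \<in> T. \<forall>v \<in> T. \<forall>w \<in> T. u \<noteq> v \<and> u \<noteq> w \<and> v \<noteq> w \<longrightarrow>
      (\<exists>p. pre_digraph.apath G u p v \<and>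
        set (pre_digraph.awalk_verts G u p) \<inter> nbhd2 G w = {}))"

end

theory Submission
  imports Defs
begin

text \<open>
  The *-C1P gives an ordering of the vertices and a symmetric relation \<open>E\<close>, namely adjacency
  together with loops at some vertices, such that for every \<open>m\<close> the set of all \<open>v\<close> with \<open>E m v\<close>
  is consecutive. If three vertices \<open>u\<close>, \<open>m\<close>, \<open>v\<close> follow each other on a walk and \<open>s\<close> is not
  \<open>E\<close>-related to \<open>m\<close>, then \<open>s\<close> cannot lie between \<open>u\<close> and \<open>v\<close>, because both of these are
  \<open>E\<close>-related to \<open>m\<close>. So a walk that avoids the neighbours of \<open>s\<close> may jump over \<open>s\<close> at a
  single step, but every second vertex of it stays on the same side of \<open>s\<close>.

  Let \<open>x\<close>, \<open>y\<close>, \<open>z\<close> be a 2-asteroidal triple, and choose \<open>a\<close>, \<open>b\<close>, \<open>c\<close> with \<open>E x a\<close>, \<open>E y b\<close>,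
  \<open>E z c\<close>. The path from \<open>x\<close> to \<open>z\<close> avoids all vertices at distance at most \<open>2\<close> from \<open>y\<close>, hence
  all neighbours of \<open>y\<close> and of \<open>b\<close>; this is where distance \<open>2\<close> is used. Extend the path to a walk
  \<open>a, x, \<dots>, z, c\<close> and look at every second vertex (\<open>link_of_walk\<close>). If the length of the path is
  even, then with respect to both \<open>y\<close> and \<open>b\<close> the vertex \<open>x\<close> is on the side of \<open>z\<close> and \<open>a\<close> on
  the side of \<open>c\<close>; if it is odd, \<open>x\<close> is on the side of \<open>c\<close> and \<open>a\<close> on the side of \<open>z\<close>. The other
  two paths give analogous facts.

  These facts about six elements of a linear order are contradictory (\<open>no_three_links\<close>).
  Exchanging the two members of one of the pairs \<open>(x, a)\<close>, \<open>(y, b)\<close>, \<open>(z, c)\<close> changes the parity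
  of the two paths at that pair, so only two cases remain. If all three parities are even, no one
  of \<open>x\<close>, \<open>y\<close>, \<open>z\<close> lies between the others, which is impossible
  (\<open>one_of_three_is_between\<close>). If all three are odd, sorting \<open>x\<close>, \<open>y\<close>, \<open>z\<close> determines the
  positions of \<open>a\<close>, \<open>b\<close>, \<open>c\<close> up to a contradiction (\<open>no_three_crosswise_links\<close>).
\<close>

section \<open>Sides of a point in a linear order\<close>

definition same_side :: "'o::linorder \<Rightarrow> 'o \<Rightarrow> 'o \<Rightarrow> bool" where
  "same_side s u v \<longleftrightarrow> u < s \<and> v < s \<or> s < u \<and> s < v"

lemma same_side_commute: "same_side s u v \<longleftrightarrow> same_side s v u"
  by (auto simp: same_side_def)

lemma same_side_trans: "same_side s u v \<Longrightarrow> same_side s v w \<Longrightarrow> same_side s u w"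
  by (auto simp: same_side_def)

lemma one_of_three_is_between:
  assumes "same_side x y z" and "same_side y x z" and "same_side z x y"
  shows False
  using assms by (auto simp: same_side_def)

text \<open>
  The trace that a walk from \<open>x\<close> to \<open>z\<close> leaves in the order, as seen from a point \<open>s\<close> whose
  neighbours it avoids: \<open>X\<close> holds the positions of \<open>x\<close> and of a neighbour of \<open>x\<close>, \<open>Z\<close> those of
  \<open>z\<close> and of a neighbour of \<open>z\<close>, and \<open>e\<close> says whether the length of the walk is even.
\<close>

definition linked :: "bool \<Rightarrow> 'o::linorder \<Rightarrow> 'o \<times> 'o \<Rightarrow> 'o \<times> 'o \<Rightarrow> bool" where
  "linked e s X Z \<longleftrightarrow>
    (if e then same_side s (fst X) (fst Z) \<and> same_side s (snd X) (snd Z)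
     else same_side s (fst X) (snd Z) \<and> same_side s (snd X) (fst Z))"

lemma linked_commute: "linked e s X Z \<longleftrightarrow> linked e s Z X"
  by (auto simp: linked_def same_side_commute)

text \<open>
  The middle point \<open>y\<close> and the outer points \<open>x\<close>, \<open>z\<close> confine \<open>c\<close> to the left and \<open>a\<close> to the
  right of \<open>y\<close>. Seen from \<open>a\<close> and from \<open>c\<close>, the point \<open>b\<close> then has to be to the right of \<open>a\<close>
  and to the left of \<open>c\<close>.
\<close>

lemma no_three_crosswise_links_sorted:
  assumes "x \<le> y" and "y \<le> z"
    and "linked False y (x, a) (z, c)" and "linked False b (x, a) (z, c)"
    and "linked False z (x, a) (y, b)" and "linked False c (x, a) (y, b)"
    and "linked False x (y, b) (z, c)" and "linked False a (y, b) (z, c)"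
  shows False
proof -
  note links = assms(3-)[unfolded linked_def same_side_def if_False fst_conv snd_conv]
  have "x < y" "y < z"
    using assms(1,2) links(1) by auto
  then have "x < c" "c < y" "y < a" "a < z"
    using links(1,3,5) by auto
  moreover have "x < b" "b < z"
    using \<open>x < y\<close> \<open>y < z\<close> links(3,5) by auto
  ultimately have "b < c" "a < b"
    using links(4,6) by auto
  with \<open>c < y\<close> \<open>y < a\<close> show False by order
qed

lemma no_three_crosswise_links:
  assumes "linked False y (x, a) (z, c)" and "linked False b (x, a) (z, c)"
    and "linked False z (x, a) (y, b)" and "linked False c (x, a) (y, b)"
    and "linked False x (y, b) (z, c)" and "linked False a (y, b) (z, c)"
  shows False
proof -
  note links = assms assms[unfolded linked_commute[of False _ "(x, a)"]]
    assms[unfolded linked_commute[of False _ "(y, b)"]]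
  consider "x \<le> y" "y \<le> z" | "x \<le> z" "z \<le> y" | "y \<le> x" "x \<le> z"
    | "y \<le> z" "z \<le> x" | "z \<le> x" "x \<le> y" | "z \<le> y" "y \<le> x"
    by (meson linear)
  then show False
    by cases (rule no_three_crosswise_links_sorted; (assumption | rule links))+
qed

text \<open>
  If the number of odd links is even, one member of each pair can be chosen such that the links
  relate the chosen members directly; otherwise exchanging the members of at most one pair makes
  all three links odd.
\<close>

lemma no_three_links:
  assumes "linked p y (x, a) (z, c)" and "linked p b (x, a) (z, c)"
    and "linked q z (x, a) (y, b)" and "linked q c (x, a) (y, b)"
    and "linked r x (y, b) (z, c)" and "linked r a (y, b) (z, c)"
  shows False
proof (cases "p = (q = r)")
  case True
  \<comment> \<open>The four combinations of \<open>q\<close> and \<open>r\<close> correspond to the four choices of members, up to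
    exchanging all three pairs at once.\<close>
  then show False
    using assms one_of_three_is_between[of x y z] one_of_three_is_between[of x y c]
      one_of_three_is_between[of x b z] one_of_three_is_between[of a y z]
    by (cases q; cases r) (auto simp: linked_def same_side_commute)
next
  case False
  then show False
    using assms no_three_crosswise_links[of y x a z c b] no_three_crosswise_links[of y x a c z b]
      no_three_crosswise_links[of b x a z c y] no_three_crosswise_links[of y a x z c b]
    by (cases q; cases r) (auto simp: linked_def)
qed

section \<open>Walks in a relation with consecutive neighbourhoods\<close>

text \<open>
  The walk \<open>x # xs\<close> is prolonged by \<open>a\<close> in front and by \<open>c\<close> at the end. Every vertex strictly
  inside the prolonged walk lies on \<open>x # xs\<close> and is thus not related to \<open>s\<close>, so its two
  neighbours on the walk are on the same side of \<open>s\<close>. In the induction \<open>x\<close> takes over the role of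
  \<open>a\<close>, which exchanges the two alternating classes of vertices.
\<close>

lemma link_of_walk:
  fixes E :: "'a \<Rightarrow> 'a \<Rightarrow> bool" and pos :: "'a \<Rightarrow> 'o::linorder"
  assumes sym: "\<And>u v. E u v \<Longrightarrow> E v u"
    and consecutive: "\<And>m u v. E m u \<Longrightarrow> E m v \<Longrightarrow> pos u \<le> pos s \<Longrightarrow> pos s \<le> pos v \<Longrightarrow> E m s"
    and "successively E (x # xs)" and "xs \<noteq> []" and "E x a" and "E (last xs) c"
    and "\<forall>m \<in> set (x # xs). \<not> E m s"
  shows "linked (even (length xs)) (pos s) (pos x, pos a) (pos (last xs), pos c)"
  using assms(3-)
proof (induction xs arbitrary: x a)
  case Nil
  then show ?case by simp
next
  case (Cons y ys)
  have step: "same_side (pos s) (pos u) (pos v)" if "E m u" "E m v" "\<not> E m s" for m u v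
  proof -
    have "\<not> (pos u \<le> pos s \<and> pos s \<le> pos v)" "\<not> (pos v \<le> pos s \<and> pos s \<le> pos u)"
      using consecutive that by blast+
    then show ?thesis 
      by (cases "pos u" "pos s" rule: linorder_cases; cases "pos v" "pos s" rule: linorder_cases)
        (auto simp: same_side_def)
  qed
  have ay: "same_side (pos s) (pos a) (pos y)"
    using Cons.prems by (intro step[of x]) auto
  show ?case
  proof (cases "ys = []")
    case True
    have "same_side (pos s) (pos x) (pos c)"
      using Cons.prems True by (intro step[of y]) (auto intro: sym)
    with ay True show ?thesis by (simp add: linked_def)
  next
    case False
    have "linked (even (length ys)) (pos s) (pos y, pos x) (pos (last ys), pos c)"
      using Cons.prems False by (intro Cons.IH) (auto intro: sym)
    with ay False show ?thesis
      by (auto simp: linked_def intro: same_side_trans)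
  qed
qed

section \<open>From graphs to ordered relations\<close>

text \<open>
  The relation \<open>E\<close> is the matrix with the modified diagonal, and \<open>pos\<close> numbers the vertices in
  the order of the permuted rows. The C1P speaks of columns; as an adjacency matrix is symmetric and
  remains so when its diagonal is changed, the rows of \<open>E\<close> have consecutive ones as well.
\<close>

lemma star_C1P_consecutive_order:
  assumes "Digraph.graph G" and "star_C1P G"
  obtains E :: "'a \<Rightarrow> 'a \<Rightarrow> bool" and pos :: "'a \<Rightarrow> nat"
  where "\<And>u v. u \<rightarrow>\<^bsub>G\<^esub> v \<Longrightarrow> E u v"
    and "\<And>u v. E u v \<Longrightarrow> v \<in> verts G \<and> (u = v \<or> u \<rightarrow>\<^bsub>G\<^esub> v)"
    and "\<And>u v. E u v \<Longrightarrow> E v u"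
    and "\<And>m u v s. E m u \<Longrightarrow> E m v \<Longrightarrow> s \<in> verts G \<Longrightarrow> pos u \<le> pos s \<Longrightarrow> pos s \<le> pos v \<Longrightarrow> E m s"
proof -
  interpret graph G by fact
  let ?V = "verts G" and ?n = "card (verts G)"
  obtain A\<^sub>0 A where "is_adjacency_mat G A\<^sub>0" and A_dim: "A \<in> carrier_mat ?n ?n"
    and offdiag: "\<forall>i < ?n. \<forall>j < ?n. i \<noteq> j \<longrightarrow> A $$ (i, j) = A\<^sub>0 $$ (i, j)" and "C1P A"
    using assms(2) unfolding star_C1P_def by (elim exE conjE) (rule that)
  then obtain f where f: "bij_betw f {..<?n} ?V"
    and A\<^sub>0: "A\<^sub>0 = mat ?n ?n (\<lambda>(i, j). if f i \<rightarrow>\<^bsub>G\<^esub> f j then 1 else 0)"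
    unfolding is_adjacency_mat_def by (elim exE conjE) (rule that)
  obtain \<pi> where \<pi>: "\<pi> permutes {..<dim_row A}"
    and conv: "\<forall>j < dim_col A. \<forall>i k l. i \<le> k \<and> k \<le> l \<and> l < dim_row A \<and>
        A $$ (\<pi> i, j) = 1 \<and> A $$ (\<pi> l, j) = 1 \<longrightarrow> A $$ (\<pi> k, j) = 1"
    using \<open>C1P A\<close> unfolding C1P_def by (elim exE conjE) (rule that)
  have dims: "dim_row A = ?n" "dim_col A = ?n" using A_dim by auto
  note \<pi> = \<pi>[unfolded dims]
  have A_adj: "A $$ (i, j) = (if f i \<rightarrow>\<^bsub>G\<^esub> f j then 1 else 0)"
    if "i < ?n" "j < ?n" "i \<noteq> j" for i j
    using that offdiag by (simp add: A\<^sub>0)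
  have A_conv: "A $$ (\<pi> k, j) = 1"
    if "j < ?n" "i \<le> k" "k \<le> l" "l < ?n" "A $$ (\<pi> i, j) = 1" "A $$ (\<pi> l, j) = 1" for i j k l
    using that conv unfolding dims by blast
  define idx where "idx = inv_into {..<?n} f"
  have idx: "idx u < ?n" "f (idx u) = u" if "u \<in> ?V" for u
    using that bij_betwE[OF bij_betw_inv_into[OF f]] bij_betw_inv_into_right[OF f]
    by (auto simp: idx_def)
  define pos where "pos u = inv_into UNIV \<pi> (idx u)" for u
  have pos: "pos u < ?n" "\<pi> (pos u) = idx u" if "u \<in> ?V" for u
    using idx(1)[OF that] permutes_in_image[OF permutes_inv[OF \<pi>], of "idx u"]
      permutes_inverses(1)[OF \<pi>]
    by (auto simp: pos_def)
  define E where "E u v \<longleftrightarrow> u \<in> ?V \<and> v \<in> ?V \<and> A $$ (idx u, idx v) = 1" for u v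
  have E_adj: "E u v \<longleftrightarrow> u \<rightarrow>\<^bsub>G\<^esub> v" if "u \<in> ?V" "v \<in> ?V" "u \<noteq> v" for u v
  proof -
    have "idx u \<noteq> idx v" using that idx(2) by metis
    then show ?thesis using that idx A_adj[of "idx u" "idx v"] by (simp add: E_def)
  qed
  have E_verts: "u \<in> ?V" "v \<in> ?V" if "E u v" for u v
    using that by (simp_all add: E_def)
  have E_sym: "E v u" if "E u v" for u v
    using that E_verts E_adj arcs_ends_symmetric[OF sym_arcs] by metis
  show thesis
  proof (rule that)
    show "E u v" if "u \<rightarrow>\<^bsub>G\<^esub> v" for u v
      using E_adj that adj_not_same adj_in_verts by metis
    show "v \<in> ?V \<and> (u = v \<or> u \<rightarrow>\<^bsub>G\<^esub> v)" if "E u v" for u v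
      using that E_adj E_verts by metis
    show "E v u" if "E u v" for u v using that by (rule E_sym)
    show "E m s" if "E m u" "E m v" "s \<in> ?V" "pos u \<le> pos s" "pos s \<le> pos v" for m u v s
    proof (rule E_sym)
      have "E u m" "E v m" using that E_sym by blast+
      then show "E s m"
        using A_conv[OF idx(1) that(4,5) pos(1)] that(3) pos(2) by (simp add: E_def)
    qed
  qed
qed

text \<open>
  Each of the two steps may stand still, so this covers the distances \<open>0\<close>, \<open>1\<close> and \<open>2\<close> at once.
\<close>

lemma (in wf_digraph) in_nbhd2_if_two_steps:
  assumes "w \<in> verts G" and "w = m \<or> w \<rightarrow>\<^bsub>G\<^esub> m" and "m = v \<or> m \<rightarrow>\<^bsub>G\<^esub> v"
  shows "v \<in> nbhd2 G w"
proof -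
  have step: "\<exists>p. awalk u p v \<and> awalk_cost (\<lambda>_. 1) p \<le> 1"
    if "u \<in> verts G" "u = v \<or> u \<rightarrow>\<^bsub>G\<^esub> v" for u v
    using that(2)
  proof
    assume "u = v"
    with that(1) show ?thesis by (intro exI[of _ "[]"]) (simp add: awalk_Nil_iff)
  next
    assume "u \<rightarrow>\<^bsub>G\<^esub> v"
    then obtain e where "e \<in> arcs G" "tail G e = u" "head G e = v"
      by (auto simp: arcs_ends_conv)
    then show ?thesis by (intro exI[of _ "[e]"]) (auto simp: arc_implies_awalk)
  qed
  obtain p where p: "awalk w p m" "awalk_cost (\<lambda>_. 1) p \<le> 1"
    using step[OF assms(1,2)] by blast
  obtain q where q: "awalk m q v" "awalk_cost (\<lambda>_. 1) q \<le> 1"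
    using step[OF _ assms(3)] p(1) by blast
  have "graph_dist G w v \<le> awalk_cost (\<lambda>_. 1) (p @ q)"
    unfolding graph_dist_def using p q by (intro min_cost_le_walk_cost) auto
  also have "\<dots> \<le> 2" using p q by simp
  finally show ?thesis using q(1) by (auto simp: nbhd2_def)
qed

lemma (in wf_digraph) successively_dominates_awalk_verts:
  "awalk u p v \<Longrightarrow> successively (\<lambda>u v. u \<rightarrow>\<^bsub>G\<^esub> v) (awalk_verts u p)"
  by (induction p arbitrary: u)
    (auto simp: awalk_Cons_iff successively_Cons in_arcs_imp_in_arcs_ends
      awalk_verts_conv hd_append hd_map split: if_splits)

section \<open>Absence of 2-asteroidal triples\<close>

theorem theorem4:
  fixes G :: "('a, 'b) pre_digraph"
  assumes "Digraph.graph G"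
    and "Digraph_Component.connected G"
    and "star_C1P G"
  shows "\<not> (\<exists>T. two_asteroidal_triple G T)"
proof
  assume "\<exists>T. two_asteroidal_triple G T"
  then obtain T where T: "two_asteroidal_triple G T" ..
  interpret graph G by fact
  obtain E pos where E_adj: "\<And>u v. u \<rightarrow>\<^bsub>G\<^esub> v \<Longrightarrow> E u v"
    and E_D: "\<And>u v. E u v \<Longrightarrow> v \<in> verts G \<and> (u = v \<or> u \<rightarrow>\<^bsub>G\<^esub> v)"
    and E_sym: "\<And>u v. E u v \<Longrightarrow> E v u"
    and E_consecutive: "\<And>m u v s. E m u \<Longrightarrow> E m v \<Longrightarrow> s \<in> verts G \<Longrightarrow>
        (pos u :: nat) \<le> pos s \<Longrightarrow> pos s \<le> pos v \<Longrightarrow> E m s"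
    by (rule star_C1P_consecutive_order[OF assms(1,3)]) (rule that; assumption)
  obtain x y z where xyz: "T = {x, y, z}" "x \<noteq> y" "x \<noteq> z" "y \<noteq> z"
    using T by (auto simp: two_asteroidal_triple_def card_3_iff)
  have walk: "\<exists>vs. vs \<noteq> [] \<and> last vs = v \<and> successively E (u # vs) \<and> set (u # vs) \<inter> nbhd2 G w = {}"
    if uvw: "u \<in> T" "v \<in> T" "w \<in> T" "u \<noteq> v" "u \<noteq> w" "v \<noteq> w" for u v w
  proof -
    obtain p where "apath u p v" and avoid: "set (awalk_verts u p) \<inter> nbhd2 G w = {}"
      using T uvw unfolding two_asteroidal_triple_def by blast
    then have p: "awalk u p v" by (simp add: apath_def)
    then obtain vs where vs: "awalk_verts u p = u # vs"
      by (metis awalkE awalk_verts_non_Nil list.exhaust_sel)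
    moreover have "last (u # vs) = v" using p vs by (metis awalkE)
    moreover have "successively E (u # vs)"
      using successively_mono[OF successively_dominates_awalk_verts[OF p], of E] E_adj vs by simp
    ultimately show ?thesis using avoid uvw by (auto split: if_splits)
  qed
  \<comment> \<open>The second vertex of a path that starts at \<open>u\<close> is a neighbour of \<open>u\<close>.\<close>
  have "\<exists>a. E u a" if uT: "u \<in> T" for u
  proof -
    obtain v w where "v \<in> T" "w \<in> T" "u \<noteq> v" "u \<noteq> w" "v \<noteq> w" using xyz uT by auto
    from walk[OF uT this] show ?thesis by (auto simp: successively_Cons)
  qed
  then obtain g where g: "\<And>u. u \<in> T \<Longrightarrow> E u (g u)" by metis
  have link: "\<exists>e. \<forall>s \<in> {w, g w}. linked e (pos s) (pos u, pos (g u)) (pos v, pos (g v))"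
    if uvw: "u \<in> T" "v \<in> T" "w \<in> T" "u \<noteq> v" "u \<noteq> w" "v \<noteq> w" for u v w
  proof -
    obtain vs where vs: "vs \<noteq> []" "last vs = v" "successively E (u # vs)"
        "set (u # vs) \<inter> nbhd2 G w = {}"
      using walk[OF uvw] by blast
    have w: "w \<in> verts G" using E_D[OF E_sym[OF g[OF uvw(3)]]] by simp
    have "linked (even (length vs)) (pos s) (pos u, pos (g u)) (pos v, pos (g v))"
      if s: "s \<in> {w, g w}" for s
    proof -
      have s_near: "s \<in> verts G" "w = s \<or> w \<rightarrow>\<^bsub>G\<^esub> s"
        using s w E_D[OF g[OF uvw(3)]] by auto
      \<comment> \<open>A neighbour \<open>m\<close> of \<open>s\<close> can be reached from \<open>w\<close> via \<open>s\<close> in at most two steps.\<close>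
      have "\<not> E m s" if m: "m \<in> set (u # vs)" for m
      proof
        assume "E m s"
        then have "s = m \<or> s \<rightarrow>\<^bsub>G\<^esub> m" using E_D E_sym by blast
        then have "m \<in> nbhd2 G w" using in_nbhd2_if_two_steps w s_near(2) by blast
        then show False using vs(4) m by blast
      qed
      then show ?thesis
        using link_of_walk[of E pos s u vs "g u" "g v"] E_sym E_consecutive s_near(1) vs g uvw
        by blast
    qed
    then show ?thesis by blast
  qed
  have "x \<in> T" "y \<in> T" "z \<in> T" using xyz by auto
  then obtain p q r
    where "\<forall>s \<in> {y, g y}. linked p (pos s) (pos x, pos (g x)) (pos z, pos (g z))"
      and "\<forall>s \<in> {z, g z}. linked q (pos s) (pos x, pos (g x)) (pos y, pos (g y))"
      and "\<forall>s \<in> {x, g x}. linked r (pos s) (pos y, pos (g y)) (pos z, pos (g z))"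
    using link[of x z y] link[of x y z] link[of y z x] xyz by metis
  then show False
    using no_three_links[of p "pos y" "pos x" "pos (g x)" "pos z" "pos (g z)" "pos (g y)" q r]
    by blast
qed

end
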